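(* Let $n\geq2$ and $k\geq1$ be integers. The multiple zeta value $\zeta(\{n\}^k)$ of length $k$ can be expressed as a linear combination of products of ordinary Riemann $\zeta$ values. In particular, $$\zeta(\{n\}^k)=(-1)^k\left[z^{nk}\right]\exp\left(-\sum_{j\geq1}\frac{\zeta(nj)}{j}z^{nj}\right).$$
   Context: $\zeta(\cdot)$ with one argument is the Riemann zeta function. $\zeta(\{n\}^k):=\sum_{n_1>n_2>\dots>n_k\geq1}\frac{1}{(n_1n_2\cdots n_k)^n}$. $[z^N]f$ denotes the coefficient of $z^N$ in the power series $f$. *)

theory Defs
  imports
    "HOL-Analysis.Analysis"
    "HOL-Computational_Algebra.Formal_Power_Series"
    "HOL-Library.Multiset"
begin

(* The Dirichlet series converges, and so gives the Riemann zeta function, only for s > 1;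
   values at other arguments are meaningless. *)
definition riemann_zeta :: "real \<Rightarrow> real" where
  "riemann_zeta s = (\<Sum>m. 1 / real (Suc m) powr s)"

(* Lists [n_1, ..., n_k] with n_1 > ... > n_k >= 1. *)
definition decreasing_lists :: "nat \<Rightarrow> nat list set" where
  "decreasing_lists k = {ns. length ns = k \<and> sorted_wrt (>) ns \<and> (\<forall>m\<in>set ns. m \<ge> 1)}"

definition mzv_repeated :: "nat \<Rightarrow> nat \<Rightarrow> real" where
  "mzv_repeated n k = (\<Sum>\<^sub>\<infinity>ns\<in>decreasing_lists k. 1 / real (prod_list ns) ^ n)"

(* The infinite sum is taken in the usual (X-adic) topology on formal power series;
   the index is shifted so that Suc j runs over the integers >= 1. *)
definition zeta_log_series :: "nat \<Rightarrow> real fps" where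
  "zeta_log_series n =
     (\<Sum>j. fps_const (riemann_zeta (real (n * Suc j)) / real (Suc j)) * fps_X ^ (n * Suc j))"

(* Linear combinations are over the rationals, since over the reals the notion is void.
   A multiset M stands for the product of the values zeta(m), m in M; the empty product
   is not admitted. *)
definition lin_comb_of_zeta_products :: "real \<Rightarrow> bool" where
  "lin_comb_of_zeta_products x \<longleftrightarrow>
     (\<exists>(S :: nat multiset set) (c :: nat multiset \<Rightarrow> rat).
        finite S \<and>
        (\<forall>M\<in>S. M \<noteq> {#} \<and> (\<forall>m\<in>#M. m \<ge> 2)) \<and>
        x = (\<Sum>M\<in>S. of_rat (c M) * (\<Prod>m\<in>#M. riemann_zeta (real m))))"

end

theory Submission imports Defs begin

text \<open>
  With \<open>a\<^sub>m = 1 / m ^ n\<close>, the value \<open>\<zeta>({n}\<^sup>k)\<close> is the \<open>k\<close>-th elementary symmetric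
  function of the infinitely many quantities \<open>a\<^sub>1, a\<^sub>2, \<dots>\<close>, and \<open>\<zeta>(n i)\<close> is their
  \<open>i\<close>-th power sum. Newton's identities therefore give, for \<open>e\<^sub>k = \<zeta>({n}\<^sup>k)\<close>,
  \<open>k e\<^sub>k = (\<Sum>i=1..k. (- 1) ^ (i - 1) * \<zeta>(n i) * e\<^bsub>k-i\<^esub>)\<close>   (lemma \<open>mzv_newton\<close>).
  They are proved for \<open>a\<^sub>1, \<dots>, a\<^sub>N\<close> by comparing coefficients in the logarithmic
  derivative of \<open>\<Prod>m=1..N. 1 + a\<^sub>m X\<close>, and then \<open>N\<close> tends to infinity.

  On the other side, let \<open>L = (\<Sum>j\<ge>1. \<zeta>(n j) / j * X ^ (n j))\<close> and \<open>F = exp (- L)\<close>. The equation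
  \<open>X F' = - (X L') F\<close> is a recurrence for the coefficients of \<open>F\<close> at multiples of \<open>n\<close>
  (lemma \<open>exp_zeta_log_newton\<close>), which is Newton's recurrence up to the sign \<open>(- 1) ^ k\<close>.
  Both sequences start with 1, so they agree (lemma \<open>mzv_eq_coeff_exp\<close>).

  Dividing Newton's recurrence by \<open>k\<close> also expresses \<open>e\<^sub>k\<close> through \<open>e\<^sub>0, \<dots>, e\<^bsub>k-1\<^esub>\<close>
  using only rational factors and zeta values, so that every \<open>e\<^sub>k\<close> with \<open>k \<ge> 1\<close> is a
  rational linear combination of products of zeta values (lemma \<open>lin_comb_mzv\<close>).
\<close>

section \<open>Elementary symmetric functions of finitely many quantities\<close>

text \<open>The decreasing lists of length \<open>k\<close> with entries in \<open>{1..N}\<close>; they encode the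
  \<open>k\<close>-element subsets of \<open>{1..N}\<close>.\<close>

definition decreasing_lists_upto :: "nat \<Rightarrow> nat \<Rightarrow> nat list set" where
  "decreasing_lists_upto N k = {ns \<in> decreasing_lists k. \<forall>m\<in>set ns. m \<le> N}"

lemma decreasing_lists_upto_0: "decreasing_lists_upto N 0 = {[]}"
  by (auto simp: decreasing_lists_upto_def decreasing_lists_def)

lemma decreasing_lists_upto_0_Suc: "decreasing_lists_upto 0 (Suc k) = {}"
  by (auto simp: decreasing_lists_upto_def decreasing_lists_def length_Suc_conv)

text \<open>Since lists decrease, an entry \<open>Suc N\<close> can only be the head.\<close>

lemma decreasing_lists_upto_Suc_Suc:
  "decreasing_lists_upto (Suc N) (Suc k) =
     decreasing_lists_upto N (Suc k) \<union> (#) (Suc N) ` decreasing_lists_upto N k"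
proof (intro subset_antisym subsetI)
  fix ns assume ns: "ns \<in> decreasing_lists_upto (Suc N) (Suc k)"
  then obtain m ms where "ns = m # ms"
    by (auto simp: decreasing_lists_upto_def decreasing_lists_def length_Suc_conv)
  with ns show "ns \<in> decreasing_lists_upto N (Suc k) \<union> (#) (Suc N) ` decreasing_lists_upto N k"
    by (cases "m = Suc N")
       (fastforce simp: decreasing_lists_upto_def decreasing_lists_def)+
qed (auto simp: decreasing_lists_upto_def decreasing_lists_def less_Suc_eq_le intro: le_SucI)

lemma finite_decreasing_lists_upto: "finite (decreasing_lists_upto N k)"
proof (rule finite_subset)
  show "decreasing_lists_upto N k \<subseteq> {ns. set ns \<subseteq> {..N} \<and> length ns = k}"
    by (auto simp: decreasing_lists_upto_def decreasing_lists_def)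
qed (simp add: finite_lists_length_eq)

text \<open>The \<open>k\<close>-th elementary symmetric function of \<open>a 1, \<dots>, a N\<close>. The value \<open>a 0\<close> plays
  no role.\<close>

definition elem_sym :: "(nat \<Rightarrow> 'a::comm_ring_1) \<Rightarrow> nat \<Rightarrow> nat \<Rightarrow> 'a" where
  "elem_sym a N k = (\<Sum>ns\<in>decreasing_lists_upto N k. prod_list (map a ns))"

lemma elem_sym_0: "elem_sym a N 0 = 1"
  by (simp add: elem_sym_def decreasing_lists_upto_0)

lemma elem_sym_0_Suc: "elem_sym a 0 (Suc k) = 0"
  by (simp add: elem_sym_def decreasing_lists_upto_0_Suc)

lemma elem_sym_Suc_Suc:
  "elem_sym a (Suc N) (Suc k) = elem_sym a N (Suc k) + a (Suc N) * elem_sym a N k"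
proof -
  have disj: "decreasing_lists_upto N (Suc k) \<inter> (#) (Suc N) ` decreasing_lists_upto N k = {}"
    by (auto simp: decreasing_lists_upto_def)
  show ?thesis
    unfolding elem_sym_def decreasing_lists_upto_Suc_Suc
    by (subst sum.union_disjoint[OF _ _ disj])
       (simp_all add: finite_decreasing_lists_upto sum.reindex sum_distrib_left)
qed

lemma fps_prod_nth_elem_sym:
  "fps_nth (\<Prod>m=1..N. 1 + fps_const (a m) * fps_X) k = elem_sym a N k"
proof (induction N arbitrary: k)
  case 0
  show ?case
    by (cases k) (simp_all add: elem_sym_0 elem_sym_0_Suc)
next
  case (Suc N)
  let ?E = "\<Prod>m=1..N. 1 + fps_const (a m) * fps_X"
  have "(\<Prod>m=1..Suc N. 1 + fps_const (a m) * fps_X) =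
          ?E + fps_const (a (Suc N)) * (fps_X * ?E)"
    by (simp add: algebra_simps)
  with Suc.IH show ?case
    by (cases k) (simp_all add: elem_sym_0 elem_sym_Suc_Suc)
qed

text \<open>The generating function \<open>p\<^sub>1 X - p\<^sub>2 X\<^sup>2 + p\<^sub>3 X\<^sup>3 - \<dots>\<close> of the power sums \<open>p\<^sub>i\<close> of
  \<open>a 1, \<dots>, a N\<close>.\<close>

definition alt_power_sum_fps :: "(nat \<Rightarrow> 'a::comm_ring_1) \<Rightarrow> nat \<Rightarrow> 'a fps" where
  "alt_power_sum_fps a N =
     Abs_fps (\<lambda>i. if i = 0 then 0 else (- 1) ^ (i - 1) * (\<Sum>m=1..N. a m ^ i))"

text \<open>Newton's identities as an equation between power series: with
  \<open>E = (\<Prod>m=1..N. 1 + a m * X)\<close>, the quotient \<open>X E' / E\<close> is the sum of the geometric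
  series \<open>a m * X / (1 + a m * X)\<close>.\<close>

lemma fps_newton:
  "fps_X * fps_deriv (\<Prod>m=1..N. 1 + fps_const (a m) * fps_X) =
     alt_power_sum_fps a N * (\<Prod>m=1..N. 1 + fps_const (a m) * fps_X)"
proof (induction N)
  case 0
  have "alt_power_sum_fps a 0 = 0"
    by (rule fps_ext) (simp add: alt_power_sum_fps_def)
  then show ?case by simp
next
  case (Suc N)
  let ?E = "\<Prod>m=1..N. 1 + fps_const (a m) * fps_X"
  define c where "c = fps_const (a (Suc N))"
  define Q where "Q = Abs_fps (\<lambda>i. if i = 0 then 0 else (- 1) ^ (i - 1) * a (Suc N) ^ i)"
  have P: "alt_power_sum_fps a (Suc N) = alt_power_sum_fps a N + Q"
    by (rule fps_ext) (simp add: alt_power_sum_fps_def Q_def distrib_left)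
  \<comment> \<open>\<open>Q\<close> is the geometric series \<open>c X / (1 + c X)\<close>.\<close>
  have Q: "Q + c * fps_X * Q = c * fps_X"
  proof (rule fps_ext)
    fix i
    have "fps_nth (Q + c * (fps_X * Q)) i = fps_nth (c * fps_X) i"
      by (cases i; cases "i - 1") (simp_all add: Q_def c_def)
    then show "fps_nth (Q + c * fps_X * Q) i = fps_nth (c * fps_X) i"
      by (simp only: mult.assoc)
  qed
  have "fps_X * fps_deriv (?E * (1 + c * fps_X)) =
          (fps_X * fps_deriv ?E) * (1 + c * fps_X) + ?E * (c * fps_X)"
    by (simp add: c_def algebra_simps)
  also have "\<dots> = (alt_power_sum_fps a N * ?E) * (1 + c * fps_X) + ?E * (Q + c * fps_X * Q)"
    by (simp only: Suc.IH Q)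
  also have "\<dots> = (alt_power_sum_fps a N + Q) * (?E * (1 + c * fps_X))"
    by (simp add: algebra_simps)
  finally show ?case
    by (simp add: P c_def)
qed

lemma fps_X_mult_deriv_nth:
  "fps_nth (fps_X * fps_deriv f) k = of_nat k * fps_nth (f :: 'a::comm_ring_1 fps) k"
  by (cases k) simp_all

lemma newton_identity_finite:
  "of_nat k * elem_sym a N k =
     (\<Sum>i=1..k. (- 1) ^ (i - 1) * (\<Sum>m=1..N. a m ^ i) * elem_sym a N (k - i))"
proof -
  have "of_nat k * elem_sym a N k =
          fps_nth (fps_X * fps_deriv (\<Prod>m=1..N. 1 + fps_const (a m) * fps_X)) k"
    by (simp only: fps_X_mult_deriv_nth fps_prod_nth_elem_sym)
  also have "\<dots> = (\<Sum>i=0..k. fps_nth (alt_power_sum_fps a N) i * elem_sym a N (k - i))"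
    by (simp only: fps_newton fps_mult_nth fps_prod_nth_elem_sym)
  also have "\<dots> = (\<Sum>i=1..k. (- 1) ^ (i - 1) * (\<Sum>m=1..N. a m ^ i) * elem_sym a N (k - i))"
    by (rule sum.mono_neutral_cong_right) (auto simp: alt_power_sum_fps_def)
  finally show ?thesis .
qed

section \<open>Passage to infinitely many quantities\<close>

lemma elem_sym_nonneg:
  fixes a :: "nat \<Rightarrow> real"
  assumes "\<And>m. a m \<ge> 0"
  shows "elem_sym a N k \<ge> 0"
  unfolding elem_sym_def using assms by (intro sum_nonneg prod_list_nonneg) auto

lemma elem_sym_le:
  fixes a :: "nat \<Rightarrow> real"
  assumes nonneg: "\<And>m. a m \<ge> 0" and bound: "\<And>N. (\<Sum>m=1..N. a m) \<le> S"
  shows "elem_sym a N k \<le> S ^ k"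
proof (induction k arbitrary: N)
  case 0
  show ?case by (simp add: elem_sym_0)
next
  case (Suc k)
  have S: "S \<ge> 0"
    using bound[of 0] by simp
  \<comment> \<open>Passing from \<open>N\<close> to \<open>Suc N\<close> adds \<open>a (Suc N) * elem_sym a N k\<close>, at most \<open>a (Suc N) * S ^ k\<close>.\<close>
  have "elem_sym a N (Suc k) \<le> (\<Sum>m=1..N. a m) * S ^ k"
  proof (induction N)
    case 0
    show ?case by (simp add: elem_sym_0_Suc)
  next
    case (Suc N)
    show ?case
      using Suc mult_left_mono[OF \<open>\<And>N. elem_sym a N k \<le> S ^ k\<close>[of N] nonneg[of "Suc N"]]
      by (simp add: elem_sym_Suc_Suc distrib_right)
  qed
  also have "\<dots> \<le> S * S ^ k"
    using bound S by (intro mult_right_mono) auto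
  finally show ?case by simp
qed

lemma subset_decreasing_lists_upto:
  assumes "finite F" and "F \<subseteq> decreasing_lists k"
  shows "\<exists>N. F \<subseteq> decreasing_lists_upto N k"
proof -
  have fin: "finite (\<Union>(set ` F))"
    using assms by auto
  have "m \<le> Max (\<Union>(set ` F))" if "ns \<in> F" "m \<in> set ns" for ns m
    using that by (intro Max_ge[OF fin]) blast
  with assms(2) have "F \<subseteq> decreasing_lists_upto (Max (\<Union>(set ` F))) k"
    by (auto simp: decreasing_lists_upto_def)
  then show ?thesis ..
qed

text \<open>The bound \<open>S ^ k\<close> makes the nonnegative family summable, and the sets
  \<open>decreasing_lists_upto N k\<close> form a cofinal sequence among the finite subsets of
  \<open>decreasing_lists k\<close>, so the partial sums along this sequence tend to the infinite sum.\<close>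

lemma elem_sym_tendsto:
  fixes a :: "nat \<Rightarrow> real"
  assumes nonneg: "\<And>m. a m \<ge> 0" and bound: "\<And>N. (\<Sum>m=1..N. a m) \<le> S"
  shows "(\<lambda>N. elem_sym a N k) \<longlonglongrightarrow> (\<Sum>\<^sub>\<infinity>ns\<in>decreasing_lists k. prod_list (map a ns))"
proof -
  let ?f = "\<lambda>ns. prod_list (map a ns)"
  have f_nonneg: "?f ns \<ge> 0" for ns
    using nonneg by (intro prod_list_nonneg) auto
  have "sum ?f F \<le> S ^ k" if F: "finite F" "F \<subseteq> decreasing_lists k" for F
  proof -
    obtain N where "F \<subseteq> decreasing_lists_upto N k"
      using subset_decreasing_lists_upto[OF F] by blast
    then have "sum ?f F \<le> elem_sym a N k"
      unfolding elem_sym_def using f_nonneg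
      by (intro sum_mono2) (auto simp: finite_decreasing_lists_upto)
    also have "\<dots> \<le> S ^ k"
      using assms by (rule elem_sym_le)
    finally show ?thesis .
  qed
  then have "?f summable_on decreasing_lists k"
    using f_nonneg by (intro nonneg_bdd_above_summable_on bdd_aboveI[of _ "S ^ k"]) auto
  then have "(sum ?f \<longlongrightarrow> infsum ?f (decreasing_lists k)) (finite_subsets_at_top (decreasing_lists k))"
    using has_sum_infsum has_sum_def by blast
  moreover have "filterlim (\<lambda>N. decreasing_lists_upto N k)
                   (finite_subsets_at_top (decreasing_lists k)) sequentially"
    unfolding filterlim_finite_subsets_at_top
  proof (intro allI impI)
    fix F assume F: "finite F \<and> F \<subseteq> decreasing_lists k"
    then obtain M where M: "F \<subseteq> decreasing_lists_upto M k"
      using subset_decreasing_lists_upto by blast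
    have "F \<subseteq> decreasing_lists_upto N k" if "N \<ge> M" for N
      using M that unfolding decreasing_lists_upto_def by (blast intro: le_trans)
    moreover have "decreasing_lists_upto N k \<subseteq> decreasing_lists k" for N
      by (auto simp: decreasing_lists_upto_def)
    ultimately show "\<forall>\<^sub>F N in sequentially. finite (decreasing_lists_upto N k) \<and>
                 F \<subseteq> decreasing_lists_upto N k \<and> decreasing_lists_upto N k \<subseteq> decreasing_lists k"
      by (intro eventually_sequentiallyI[of M]) (simp add: finite_decreasing_lists_upto)
  qed
  ultimately show ?thesis
    unfolding elem_sym_def by (rule filterlim_compose)
qed

section \<open>Newton's identities for multiple zeta values\<close>

lemma riemann_zeta_tendsto:
  assumes "s \<ge> 2"
  shows "(\<lambda>N. \<Sum>m=1..N. 1 / real m ^ s) \<longlonglongrightarrow> riemann_zeta (real s)"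
    and "(\<Sum>m=1..N. 1 / real m ^ s) \<le> riemann_zeta (real s)"
proof -
  have "summable (\<lambda>m. 1 / real m ^ s)"
    using inverse_power_summable[OF assms, where 'a = real] by (simp add: divide_inverse)
  then have sums: "summable (\<lambda>m. 1 / real (Suc m) ^ s)"
    by (subst summable_Suc_iff)
  have zeta: "riemann_zeta (real s) = (\<Sum>m. 1 / real (Suc m) ^ s)"
    unfolding riemann_zeta_def by (subst powr_realpow) auto
  have partial: "(\<Sum>m=1..N. 1 / real m ^ s) = (\<Sum>m<N. 1 / real (Suc m) ^ s)" for N
    using sum.atLeast1_atMost_eq[of "\<lambda>m. 1 / real m ^ s" N] by simp
  show "(\<lambda>N. \<Sum>m=1..N. 1 / real m ^ s) \<longlonglongrightarrow> riemann_zeta (real s)"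
    unfolding zeta partial using sums by (rule summable_LIMSEQ)
  show "(\<Sum>m=1..N. 1 / real m ^ s) \<le> riemann_zeta (real s)"
    unfolding zeta partial using sums by (intro sum_le_suminf) auto
qed

lemma prod_list_reciprocal_powers:
  "prod_list (map (\<lambda>m. 1 / real m ^ n) ns) = 1 / real (prod_list ns) ^ n"
  by (induction ns) (simp_all add: power_mult_distrib)

lemma elem_sym_tendsto_mzv:
  assumes "n \<ge> 2"
  shows "(\<lambda>N. elem_sym (\<lambda>m. 1 / real m ^ n) N k) \<longlonglongrightarrow> mzv_repeated n k"
  using elem_sym_tendsto[of "\<lambda>m. 1 / real m ^ n" "riemann_zeta (real n)" k]
        riemann_zeta_tendsto(2)[OF assms]
  by (simp add: mzv_repeated_def prod_list_reciprocal_powers)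

lemma mzv_repeated_0: "mzv_repeated n 0 = 1"
proof -
  have "decreasing_lists 0 = {[]}"
    by (auto simp: decreasing_lists_def)
  then show ?thesis
    by (simp add: mzv_repeated_def)
qed

lemma mzv_newton:
  assumes "n \<ge> 2"
  shows "real k * mzv_repeated n k =
           (\<Sum>i=1..k. (- 1) ^ (i - 1) * riemann_zeta (real (n * i)) * mzv_repeated n (k - i))"
proof (rule LIMSEQ_unique)
  let ?a = "\<lambda>m. 1 / real m ^ n"
  show "(\<lambda>N. real k * elem_sym ?a N k) \<longlonglongrightarrow> real k * mzv_repeated n k"
    by (intro tendsto_mult_left elem_sym_tendsto_mzv assms)
  have "(\<lambda>N. \<Sum>m=1..N. ?a m ^ i) \<longlonglongrightarrow> riemann_zeta (real (n * i))" if "i \<ge> 1" for i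
  proof -
    have "n * i \<ge> 2"
      using mult_le_mono[OF assms that] by simp
    from riemann_zeta_tendsto(1)[OF this] show ?thesis
      by (simp add: power_mult power_one_over)
  qed
  then show "(\<lambda>N. real k * elem_sym ?a N k) \<longlonglongrightarrow>
      (\<Sum>i=1..k. (- 1) ^ (i - 1) * riemann_zeta (real (n * i)) * mzv_repeated n (k - i))"
    unfolding newton_identity_finite
    by (intro tendsto_sum tendsto_mult tendsto_const elem_sym_tendsto_mzv assms) auto
qed

section \<open>The exponential of the zeta series\<close>

lemma zeta_log_series_nth:
  assumes "n \<ge> 1"
  shows "fps_nth (zeta_log_series n) m =
           (if n dvd m \<and> m > 0 then riemann_zeta (real m) / real (m div n) else 0)"
proof -
  define g where
    "g j = fps_const (riemann_zeta (real (n * Suc j)) / real (Suc j)) * fps_X ^ (n * Suc j)" for j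
  define L where
    "L = Abs_fps (\<lambda>m. if n dvd m \<and> m > 0 then riemann_zeta (real m) / real (m div n) else 0)"
  have g_nth: "fps_nth (g j) m =
      (if m = n * Suc j then riemann_zeta (real (n * Suc j)) / real (Suc j) else 0)" for j m
    unfolding g_def by (simp add: fps_X_power_nth del: mult_Suc_right of_nat_mult of_nat_Suc)
  have "(\<lambda>J. \<Sum>j<J. g j) \<longlonglongrightarrow> L"
  proof (rule tendsto_fpsI)
    fix m
    have "fps_nth (\<Sum>j<J. g j) m = fps_nth L m" if J: "J \<ge> m" for J
    proof (cases "n dvd m \<and> m > 0")
      case True
      then obtain q where q: "m = n * q" by (elim conjE dvdE)
      with True obtain j where j: "m = n * Suc j" by (cases q) auto
      \<comment> \<open>Only the term with index \<open>j\<close> contributes to the coefficient of \<open>X ^ m\<close>, and \<open>j < m \<le> J\<close>.\<close>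
      have "Suc j \<le> m"
        using assms unfolding j by (cases n) auto
      have "fps_nth (\<Sum>j<J. g j) m = (\<Sum>i<J. if i = j then fps_nth L m else 0)"
        unfolding fps_sum_nth g_nth using assms
        by (intro sum.cong refl) (auto simp: L_def j simp del: mult_Suc_right of_nat_mult of_nat_Suc)
      also have "\<dots> = fps_nth L m"
        using \<open>Suc j \<le> m\<close> J by simp
      finally show ?thesis .
    next
      case False
      then have "m \<noteq> n * Suc j" for j
        using assms by auto
      with False show ?thesis
        by (auto simp: fps_sum_nth g_nth L_def simp del: mult_Suc_right)
    qed
    then show "\<forall>\<^sub>F J in sequentially. fps_nth (\<Sum>j<J. g j) m = fps_nth L m"
      by (rule eventually_sequentiallyI)
  qed
  then have "zeta_log_series n = L"
    unfolding zeta_log_series_def g_def[symmetric] by (intro sums_unique[symmetric]) (simp add: sums_def)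
  then show ?thesis
    by (simp add: L_def)
qed

text \<open>Compare coefficients of \<open>X ^ (n * k)\<close> in \<open>X F' = - (X L') F\<close>. Here \<open>X L'\<close> has
  coefficient \<open>n * \<zeta>(m)\<close> at each positive multiple \<open>m\<close> of \<open>n\<close> and 0 elsewhere, and the common
  factor \<open>n\<close> cancels.\<close>

lemma exp_zeta_log_newton:
  assumes "n \<ge> 1"
  defines "F \<equiv> fps_compose (fps_exp 1) (- zeta_log_series n)"
  shows "real k * fps_nth F (n * k) =
           - (\<Sum>i=1..k. riemann_zeta (real (n * i)) * fps_nth F (n * (k - i)))"
proof -
  let ?L = "zeta_log_series n"
  have L0: "fps_nth (- ?L) 0 = 0"
    using assms by (simp add: zeta_log_series_nth)
  have "fps_deriv F = - (F * fps_deriv ?L)"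
    unfolding F_def by (simp add: fps_compose_deriv[OF L0])
  then have XF: "fps_X * fps_deriv F = - ((fps_X * fps_deriv ?L) * F)"
    by (simp add: algebra_simps)
  have XL: "fps_nth (fps_X * fps_deriv ?L) m =
      (if n dvd m \<and> m > 0 then real n * riemann_zeta (real m) else 0)" for m
    using assms unfolding fps_X_mult_deriv_nth by (auto simp: zeta_log_series_nth elim!: dvdE)
  have "real n * (real k * fps_nth F (n * k)) = fps_nth (fps_X * fps_deriv F) (n * k)"
    by (simp only: fps_X_mult_deriv_nth of_nat_mult mult.assoc)
  also have "\<dots> = - (\<Sum>m=0..n*k. (if n dvd m \<and> m > 0 then real n * riemann_zeta (real m) else 0)
                        * fps_nth F (n * k - m))"
    unfolding XF fps_neg_nth fps_mult_nth[of "fps_X * fps_deriv ?L"] XL ..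
  also have "(\<Sum>m=0..n*k. (if n dvd m \<and> m > 0 then real n * riemann_zeta (real m) else 0)
                * fps_nth F (n * k - m)) =
      (\<Sum>m\<in>(*) n ` {1..k}. real n * riemann_zeta (real m) * fps_nth F (n * k - m))"
    using assms by (intro sum.mono_neutral_cong_right) (auto elim!: dvdE)
  also have "\<dots> = (\<Sum>i=1..k. real n * riemann_zeta (real (n * i)) * fps_nth F (n * k - n * i))"
    using assms by (subst sum.reindex) (auto simp: inj_on_def)
  also have "\<dots> = real n * (\<Sum>i=1..k. riemann_zeta (real (n * i)) * fps_nth F (n * (k - i)))"
    by (simp add: sum_distrib_left mult.assoc diff_mult_distrib2)
  finally have "real n * (real k * fps_nth F (n * k)) =
      real n * (- (\<Sum>i=1..k. riemann_zeta (real (n * i)) * fps_nth F (n * (k - i))))"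
    by simp
  moreover have "real n \<noteq> 0"
    using assms by simp
  ultimately show ?thesis
    by (metis mult_left_cancel)
qed

lemma mzv_eq_coeff_exp:
  assumes "n \<ge> 2"
  shows "mzv_repeated n k =
           (- 1) ^ k * fps_nth (fps_compose (fps_exp 1) (- zeta_log_series n)) (n * k)"
proof (induction k rule: less_induct)
  case (less k)
  define F where "F = fps_compose (fps_exp 1) (- zeta_log_series n)"
  have n: "n \<ge> 1" using assms by simp
  show ?case
  proof (cases "k = 0")
    case True
    then show ?thesis by (simp add: mzv_repeated_0)
  next
    case False
    have "real k * mzv_repeated n k =
        (\<Sum>i=1..k. (- 1) ^ (i - 1) * riemann_zeta (real (n * i)) * mzv_repeated n (k - i))"
      by (rule mzv_newton[OF assms])
    also have "\<dots> = (\<Sum>i=1..k. - ((- 1) ^ k) * (riemann_zeta (real (n * i)) * fps_nth F (n * (k - i))))"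
    proof (rule sum.cong[OF refl])
      fix i assume i: "i \<in> {1..k}"
      have k_split: "k = Suc ((i - 1) + (k - i))"
        using i by auto
      have sign: "- ((- 1 :: real) ^ k) = (- 1) ^ (i - 1) * (- 1) ^ (k - i)"
        by (subst k_split) (simp only: power_Suc power_add mult_minus1 minus_minus)
      have "mzv_repeated n (k - i) = (- 1) ^ (k - i) * fps_nth F (n * (k - i))"
        unfolding F_def using i by (intro less.IH) auto
      then show "(- 1) ^ (i - 1) * riemann_zeta (real (n * i)) * mzv_repeated n (k - i) =
          - ((- 1) ^ k) * (riemann_zeta (real (n * i)) * fps_nth F (n * (k - i)))"
        unfolding sign by simp
    qed
    also have "\<dots> = (- 1) ^ k * (- (\<Sum>i=1..k. riemann_zeta (real (n * i)) * fps_nth F (n * (k - i))))"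
      by (simp add: sum_distrib_left sum_negf)
    also have "\<dots> = real k * ((- 1) ^ k * fps_nth F (n * k))"
      unfolding F_def exp_zeta_log_newton[OF n, symmetric] by simp
    finally show ?thesis
      using False unfolding F_def by (metis mult_left_cancel of_nat_eq_0_iff)
  qed
qed

section \<open>Rational linear combinations of products of zeta values\<close>

lemma lin_comb_zeta: "m \<ge> 2 \<Longrightarrow> lin_comb_of_zeta_products (riemann_zeta (real m))"
  unfolding lin_comb_of_zeta_products_def
  by (intro exI[of _ "{{#m#}}"] exI[of _ "\<lambda>_. 1"]) auto

lemma lin_comb_0: "lin_comb_of_zeta_products 0"
  unfolding lin_comb_of_zeta_products_def by (intro exI[of _ "{}"]) auto

lemma lin_comb_scale:
  assumes "lin_comb_of_zeta_products x"
  shows "lin_comb_of_zeta_products (of_rat q * x)"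
proof -
  obtain S c where "finite S" "\<forall>M\<in>S. M \<noteq> {#} \<and> (\<forall>m\<in>#M. m \<ge> 2)"
    "x = (\<Sum>M\<in>S. of_rat (c M) * (\<Prod>m\<in>#M. riemann_zeta (real m)))"
    using assms unfolding lin_comb_of_zeta_products_def by blast
  then show ?thesis
    unfolding lin_comb_of_zeta_products_def
    by (intro exI[of _ S] exI[of _ "\<lambda>M. q * c M"])
       (auto simp: sum_distrib_left of_rat_mult mult.assoc)
qed

lemma lin_comb_add:
  assumes "lin_comb_of_zeta_products x" and "lin_comb_of_zeta_products y"
  shows "lin_comb_of_zeta_products (x + y)"
proof -
  let ?z = "\<lambda>M. \<Prod>m\<in>#M. riemann_zeta (real m)"
  obtain S c where S: "finite S" "\<forall>M\<in>S. M \<noteq> {#} \<and> (\<forall>m\<in>#M. m \<ge> 2)"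
    and x: "x = (\<Sum>M\<in>S. of_rat (c M) * ?z M)"
    using assms(1) unfolding lin_comb_of_zeta_products_def by blast
  obtain T d where T: "finite T" "\<forall>M\<in>T. M \<noteq> {#} \<and> (\<forall>m\<in>#M. m \<ge> 2)"
    and y: "y = (\<Sum>M\<in>T. of_rat (d M) * ?z M)"
    using assms(2) unfolding lin_comb_of_zeta_products_def by blast
  define e where "e M = (if M \<in> S then c M else 0) + (if M \<in> T then d M else 0)" for M
  have "x = (\<Sum>M\<in>S \<union> T. of_rat (if M \<in> S then c M else 0) * ?z M)"
    unfolding x using S T by (intro sum.mono_neutral_cong_left) auto
  moreover have "y = (\<Sum>M\<in>S \<union> T. of_rat (if M \<in> T then d M else 0) * ?z M)"
    unfolding y using S T by (intro sum.mono_neutral_cong_left) auto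
  ultimately have "x + y = (\<Sum>M\<in>S \<union> T. of_rat (e M) * ?z M)"
    by (simp add: e_def of_rat_add distrib_right sum.distrib)
  with S T show ?thesis
    unfolding lin_comb_of_zeta_products_def
    by (intro exI[of _ "S \<union> T"] exI[of _ e]) auto
qed

lemma lin_comb_sum:
  assumes "\<And>i. i \<in> I \<Longrightarrow> lin_comb_of_zeta_products (f i)"
  shows "lin_comb_of_zeta_products (\<Sum>i\<in>I. f i)"
  using assms by (induction I rule: infinite_finite_induct) (auto intro: lin_comb_0 lin_comb_add)

lemma lin_comb_mult_zeta:
  assumes "lin_comb_of_zeta_products x" and "m \<ge> 2"
  shows "lin_comb_of_zeta_products (riemann_zeta (real m) * x)"
proof -
  obtain S c where S: "finite S" "\<forall>M\<in>S. M \<noteq> {#} \<and> (\<forall>m\<in>#M. m \<ge> 2)"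
    and x: "x = (\<Sum>M\<in>S. of_rat (c M) * (\<Prod>m\<in>#M. riemann_zeta (real m)))"
    using assms(1) unfolding lin_comb_of_zeta_products_def by blast
  have "riemann_zeta (real m) * x =
      (\<Sum>M\<in>add_mset m ` S. of_rat (c (M - {#m#})) * (\<Prod>m\<in>#M. riemann_zeta (real m)))"
    unfolding x by (subst sum.reindex) (auto simp: inj_on_def sum_distrib_left mult_ac)
  with S assms(2) show ?thesis
    unfolding lin_comb_of_zeta_products_def
    by (intro exI[of _ "add_mset m ` S"] exI[of _ "\<lambda>M. c (M - {#m#})"]) auto
qed

text \<open>Strong induction along Newton's recurrence. The summand \<open>i = k\<close> has to be treated
  separately, because \<open>mzv_repeated n 0 = 1\<close> is an empty product and the induction hypothesis
  does not cover it; this summand is a rational multiple of the single value \<open>\<zeta>(n k)\<close>.\<close>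

lemma lin_comb_mzv:
  assumes "n \<ge> 2" and "k \<ge> 1"
  shows "lin_comb_of_zeta_products (mzv_repeated n k)"
  using assms(2)
proof (induction k rule: less_induct)
  case (less k)
  have term_lin_comb: "lin_comb_of_zeta_products
      (of_rat ((- 1) ^ (i - 1) / of_nat k) * (riemann_zeta (real (n * i)) * mzv_repeated n (k - i)))"
    if i: "i \<in> {1..k}" for i
  proof (rule lin_comb_scale)
    have ni: "n * i \<ge> 2"
      using mult_le_mono[OF assms(1), of 1 i] i by simp
    show "lin_comb_of_zeta_products (riemann_zeta (real (n * i)) * mzv_repeated n (k - i))"
    proof (cases "i = k")
      case True
      then show ?thesis
        using lin_comb_zeta[OF ni] by (simp add: mzv_repeated_0)
    next
      case False
      then show ?thesis
        using i ni by (intro lin_comb_mult_zeta less.IH) auto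
    qed
  qed
  have "mzv_repeated n k = (real k * mzv_repeated n k) / real k"
    using less.prems by simp
  also have "\<dots> = (\<Sum>i=1..k. of_rat ((- 1) ^ (i - 1) / of_nat k) *
                      (riemann_zeta (real (n * i)) * mzv_repeated n (k - i)))"
    unfolding mzv_newton[OF assms(1)] sum_divide_distrib
    by (simp add: of_rat_divide of_rat_power of_rat_minus mult.assoc)
  finally show ?case
    by (simp only: lin_comb_sum[OF term_lin_comb])
qed

theorem proposition3:
  fixes n k :: nat
  assumes "n \<ge> 2" and "k \<ge> 1"
  shows "lin_comb_of_zeta_products (mzv_repeated n k) \<and>
         mzv_repeated n k =
           (- 1) ^ k * fps_nth (fps_compose (fps_exp 1) (- zeta_log_series n)) (n * k)"
  using lin_comb_mzv[OF assms] mzv_eq_coeff_exp[OF assms(1)] by blast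

end
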